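(* Let $(\mathcal{N},\mathcal{L})$ be the graph of a connected network with shunt set $\mathcal{T}$. Suppose that the branches are not mutually coupled and every branch has nonzero series admittance, so that $\mathbf{Y}_{\mathcal{L}}=\mathrm{diag}(\mathbf{y}_{\mathcal{L}})$ is diagonal and full rank, and that every branch $l\in\mathcal{L}$ has nodal admittance matrix $\mathbf{a}_l\,y_l\,\mathbf{a}_l^H$ with $\mathbf{a}_l$ as described in the context (nonzero complex tap ratio $a_l$). Suppose the network satisfies at least one of the following conditions: 1) $(\mathcal{N},\mathcal{L})$ is a tree and there exists a root node $r\in\mathcal{N}$ such that the equivalent admittance of any node to ground, under the condition that its parent node (if any) is grounded, is nonzero; 2) $(\mathcal{N},\mathcal{L})$ is a tree and $\mathcal{T}=\emptyset$; 3) there are only inductors or there are only capacitors, i.e. either all branch and shunt admittances are of the form $-jb$ with $b>0$, or all branch and shunt admittances are of the form $jb$ with $b>0$ (where $j$ is the imaginary unit). Then $\mathrm{Null}(\mathbf{Y}_{\mathcal{N}})\subseteq\mathrm{Null}(\mathbf{A}_{\mathcal{L},\mathcal{N}})$, where $\mathbf{Y}_{\mathcal{N}}=\mathbf{A}_{\mathcal{L},\mathcal{N}}^H\mathbf{Y}_{\mathcal{L}}\mathbf{A}_{\mathcal{L},\mathcal{N}}+\mathbf{Y}_{\mathcal{T}}$.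
   Context: A network consists of a finite nonempty set $\mathcal{N}$ of nodes (the ground node is not included), a finite set $\mathcal{L}$ of branches, and a finite set $\mathcal{T}$ of shunts. Each branch $l\in\mathcal{L}$ goes from a node $i$ to a different node $k$ and carries a series admittance $y_l\in\mathbb{C}$ and a tap ratio $a_l\in\mathbb{C}\setminus\{0\}$. Its vector $\mathbf{a}_l\in\mathbb{C}^{|\mathcal{N}|}$ has $i$-th entry $1$, $k$-th entry $-a_l^*$ (complex conjugate of $-a_l$), and all other entries zero; the admittance matrix of this branch alone is $\mathbf{Y}_l=\mathbf{a}_l y_l\mathbf{a}_l^H\in\mathbb{C}^{|\mathcal{N}|\times|\mathcal{N}|}$. Several branches may join the same two nodes (not when the graph is a tree), but there are no parallel branches with the same tap ratio (such branches are merged by adding admittances). Each shunt is attached to one node (connecting it to ground), has nonzero complex admittance, and there is at most one shunt per node (parallel shunts are merged). $\mathbf{A}_{\mathcal{L},\mathcal{N}}\in\mathbb{C}^{|\mathcal{L}|\times|\mathcal{N}|}$ is the generalized incidence matrix, whose $l$-th row is $\mathbf{a}_l^H$ (entries $1$ at $i$ and $-a_l$ at $k$). $\mathbf{Y}_{\mathcal{L}}=\mathrm{diag}(\mathbf{y}_{\mathcal{L}})$ is the diagonal matrix of series admittances. $\mathbf{Y}_{\mathcal{T}}=\mathrm{diag}(\mathbf{y}_{\mathcal{T}})\in\mathbb{C}^{|\mathcal{N}|\times|\mathcal{N}|}$ is the diagonal matrix whose $n$-th diagonal entry $y^s_n$ is the admittance of the shunt at node $n$ (zero if there is none). The network is connected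 if the graph $(\mathcal{N},\mathcal{L})$ is connected (ground and shunts are not used for connectivity). $(\cdot)^H$ is the conjugate transpose and $\mathrm{Null}(\cdot)$ the null space over $\mathbb{C}$. Equivalent admittances in condition 1). Let $(\mathcal{N},\mathcal{L})$ be a tree rooted at $r$; each node $n\ne r$ has a unique parent. For a node $n\neq r$ with parent $p$, let $\begin{pmatrix} y^{p,n}_{11} & y^{p,n}_{12}\\ y^{p,n}_{21} & y^{p,n}_{22}\end{pmatrix}$ be the $2\times2$ submatrix, with rows and columns ordered $(p,n)$, of the admittance matrix $\mathbf{Y}_l$ of the branch $l$ joining $p$ and $n$ (shunts excluded). Proceeding from the leaves to the root, define for every node $n$ $$y^{sb}_n=y^s_n+\sum_{i\text{ child of }n}y^b_i,\qquad\text{and for } n\ne r:\quad y^b_n=y^{p,n}_{11}-\frac{y^{p,n}_{12}\,y^{p,n}_{21}}{y^{p,n}_{22}+y^{sb}_n}.$$ The equivalent admittance of a node $n\neq r$ to ground with its parent $p$ grounded is $y^{p,n}_{22}+y^{sb}_n$; the equivalent admittance of the root $r$ (which has no parent) to ground is $y^{sb}_r$. Condition 1) says that all these numbers are nonzero (in particular, the divisions in the recursion are then well defined). *)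

theory Defs
  imports
    "Jordan_Normal_Form.Schur_Decomposition"
    "Jordan_Normal_Form.Matrix_Kernel"
    "Graph_Theory.Digraph_Component"
begin

text \<open>
  The nodes are numbered \<open>0, \<dots>, n - 1\<close> and the branches \<open>0, \<dots>, m - 1\<close>, so that they can index
  the rows and columns of matrices.  Since there is at most one shunt per node, a shunt is
  identified with the node it is attached to.
\<close>

record network =
  num_nodes :: nat
  num_branches :: nat
  branch_from :: "nat \<Rightarrow> nat"
  branch_to :: "nat \<Rightarrow> nat"
  series_adm :: "nat \<Rightarrow> complex"
  tap_ratio :: "nat \<Rightarrow> complex"
  shunts :: "nat set"
  shunt_adm :: "nat \<Rightarrow> complex"

definition network_graph :: "network \<Rightarrow> (nat, nat) pre_digraph" where
  "network_graph N =
     \<lparr>verts = {..<num_nodes N}, arcs = {..<num_branches N},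
      tail = branch_from N, head = branch_to N\<rparr>"

text \<open>
  The last conjunct excludes parallel branches with the same tap ratio; the tap ratio refers to
  the orientation of the branch, so only branches with the same orientation are compared.
\<close>

definition valid_network :: "network \<Rightarrow> bool" where
  "valid_network N \<longleftrightarrow>
     num_nodes N > 0 \<and>
     loopfree_digraph (network_graph N) \<and>
     (\<forall>l<num_branches N. tap_ratio N l \<noteq> 0) \<and>
     shunts N \<subseteq> {..<num_nodes N} \<and>
     (\<forall>v\<in>shunts N. shunt_adm N v \<noteq> 0) \<and>
     (\<forall>l<num_branches N. \<forall>l'<num_branches N.
        branch_from N l = branch_from N l' \<and> branch_to N l = branch_to N l' \<and>
        tap_ratio N l = tap_ratio N l' \<longrightarrow> l = l')"

text \<open>
  \<^const>\<open>Digraph_Component.connected\<close> ignores the orientation of arcs, as required here.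
  \<^const>\<open>Digraph_Component.tree\<close> does not: it only forbids directed cycles, so it admits, for
  example, a triangle that is not cyclically oriented.  Cycles are therefore defined below on the
  underlying undirected multigraph; two parallel branches form a cycle of length two.
\<close>

definition joins :: "network \<Rightarrow> nat \<Rightarrow> nat \<Rightarrow> nat \<Rightarrow> bool" where
  "joins N l u v \<longleftrightarrow> l < num_branches N \<and>
     (branch_from N l = u \<and> branch_to N l = v \<or> branch_from N l = v \<and> branch_to N l = u)"

definition is_cycle :: "network \<Rightarrow> nat list \<Rightarrow> nat list \<Rightarrow> bool" where
  "is_cycle N vs ls \<longleftrightarrow>
     ls \<noteq> [] \<and> length vs = length ls \<and> distinct vs \<and> distinct ls \<and>
     (\<forall>k<length ls. joins N (ls ! k) (vs ! k) (vs ! (Suc k mod length ls)))"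

definition network_connected :: "network \<Rightarrow> bool" where
  "network_connected N \<longleftrightarrow> Digraph_Component.connected (network_graph N)"

definition network_tree :: "network \<Rightarrow> bool" where
  "network_tree N \<longleftrightarrow> network_connected N \<and> (\<nexists>vs ls. is_cycle N vs ls)"

definition branch_vec :: "network \<Rightarrow> nat \<Rightarrow> complex vec" where
  "branch_vec N l = vec (num_nodes N)
     (\<lambda>v. if v = branch_from N l then 1
          else if v = branch_to N l then - cnj (tap_ratio N l)
          else 0)"

definition branch_adm_mat :: "network \<Rightarrow> nat \<Rightarrow> complex mat" where
  "branch_adm_mat N l =
     (let a = mat_of_cols (num_nodes N) [branch_vec N l]
      in series_adm N l \<cdot>\<^sub>m (a * mat_adjoint a))"

definition incidence_mat :: "network \<Rightarrow> complex mat" where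
  "incidence_mat N =
     mat_of_rows (num_nodes N) (map (\<lambda>l. conjugate (branch_vec N l)) [0..<num_branches N])"

definition series_adm_mat :: "network \<Rightarrow> complex mat" where
  "series_adm_mat N = mat_diag (num_branches N) (series_adm N)"

definition node_shunt_adm :: "network \<Rightarrow> nat \<Rightarrow> complex" where
  "node_shunt_adm N v = (if v \<in> shunts N then shunt_adm N v else 0)"

definition shunt_adm_mat :: "network \<Rightarrow> complex mat" where
  "shunt_adm_mat N = mat_diag (num_nodes N) (node_shunt_adm N)"

definition nodal_adm_mat :: "network \<Rightarrow> complex mat" where
  "nodal_adm_mat N =
     mat_adjoint (incidence_mat N) * series_adm_mat N * incidence_mat N + shunt_adm_mat N"

text \<open>
  The parent of a node is its neighbour one step closer to the root.  In a tree it exists and is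
  unique for every node other than the root, and so is the branch joining a node to its parent;
  the uses of \<open>THE\<close> below are meaningful in that case only.
\<close>

definition adjacent :: "network \<Rightarrow> (nat \<times> nat) set" where
  "adjacent N = {(u, v). \<exists>l. joins N l u v}"

definition depth :: "network \<Rightarrow> nat \<Rightarrow> nat \<Rightarrow> nat" where
  "depth N r v = (LEAST k. (r, v) \<in> adjacent N ^^ k)"

definition is_parent :: "network \<Rightarrow> nat \<Rightarrow> nat \<Rightarrow> nat \<Rightarrow> bool" where
  "is_parent N r p v \<longleftrightarrow> p < num_nodes N \<and> v < num_nodes N \<and>
     (p, v) \<in> adjacent N \<and> depth N r v = Suc (depth N r p)"

definition parent :: "network \<Rightarrow> nat \<Rightarrow> nat \<Rightarrow> nat" where
  "parent N r v = (THE p. is_parent N r p v)"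

definition children :: "network \<Rightarrow> nat \<Rightarrow> nat \<Rightarrow> nat set" where
  "children N r v = {i. is_parent N r v i}"

definition parent_branch_mat :: "network \<Rightarrow> nat \<Rightarrow> nat \<Rightarrow> complex mat" where
  "parent_branch_mat N r v = branch_adm_mat N (THE l. joins N l (parent N r v) v)"

text \<open>
  \<open>adm_sb N r v\<close> is $y^{sb}_v$ and \<open>adm_b N r v\<close> is $y^b_v$ for the root \<open>r\<close>; the latter is used
  for \<open>v \<noteq> r\<close> only.  Rows and columns of the branch matrix are indexed by the nodes themselves.
\<close>

function adm_sb :: "network \<Rightarrow> nat \<Rightarrow> nat \<Rightarrow> complex"
  and adm_b :: "network \<Rightarrow> nat \<Rightarrow> nat \<Rightarrow> complex"
where
  "adm_sb N r v = node_shunt_adm N v + (\<Sum>i\<in>children N r v. adm_b N r i)"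
| "adm_b N r v =
     parent_branch_mat N r v $$ (parent N r v, parent N r v)
     - parent_branch_mat N r v $$ (parent N r v, v) * parent_branch_mat N r v $$ (v, parent N r v)
       / (parent_branch_mat N r v $$ (v, v) + adm_sb N r v)"
  by pat_completeness auto
termination
proof -
  define c where "c N r v = card {w. w < num_nodes N \<and> depth N r v < depth N r w}" for N r v
  have less: "c N r i < c N r v" if "i \<in> children N r v" for N r v i
  proof -
    from that have i: "i < num_nodes N" "depth N r i = Suc (depth N r v)"
      by (simp_all add: children_def is_parent_def)
    show ?thesis
      unfolding c_def
    proof (rule psubset_card_mono)
      show "finite {w. w < num_nodes N \<and> depth N r v < depth N r w}"
        by simp
      have "i \<in> {w. w < num_nodes N \<and> depth N r v < depth N r w}"
        and "i \<notin> {w. w < num_nodes N \<and> depth N r i < depth N r w}"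
        using i by simp_all
      moreover have "{w. w < num_nodes N \<and> depth N r i < depth N r w} \<subseteq>
          {w. w < num_nodes N \<and> depth N r v < depth N r w}"
        using i(2) by (intro Collect_mono) simp
      ultimately show "{w. w < num_nodes N \<and> depth N r i < depth N r w} \<subset>
          {w. w < num_nodes N \<and> depth N r v < depth N r w}"
        by blast
    qed
  qed
  define M where
    "M = measure (case_sum (\<lambda>(N, r, v). 2 * c N r v) (\<lambda>(N, r, v). 2 * c N r v + 1))"
  show ?thesis
  proof
    show "wf M" by (simp add: M_def)
  next
    fix N r v i assume "i \<in> children N r v"
    from less [OF this] show "(Inr (N, r, i), Inl (N, r, v)) \<in> M"
      by (simp add: M_def)
  next
    fix N r v
    show "(Inl (N, r, v), Inr (N, r, v)) \<in> M"
      by (simp add: M_def)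
  qed
qed

declare adm_sb.simps [simp del] adm_b.simps [simp del]

definition equiv_adm_to_ground :: "network \<Rightarrow> nat \<Rightarrow> nat \<Rightarrow> complex" where
  "equiv_adm_to_ground N r v =
     (if v = r then adm_sb N r v else parent_branch_mat N r v $$ (v, v) + adm_sb N r v)"

definition is_inductor_adm :: "complex \<Rightarrow> bool" where
  "is_inductor_adm y \<longleftrightarrow> (\<exists>b::real. b > 0 \<and> y = - \<i> * complex_of_real b)"

definition is_capacitor_adm :: "complex \<Rightarrow> bool" where
  "is_capacitor_adm y \<longleftrightarrow> (\<exists>b::real. b > 0 \<and> y = \<i> * complex_of_real b)"

end

theory Submission
  imports Defs
begin

text \<open>
  Pairing \<open>Y x = 0\<close> with \<open>x\<close> settles the purely inductive or capacitive case: up to a common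
  factor it is a sum of nonnegative terms.  In a tree, Kirchhoff's current law is eliminated from
  the leaves to the root.  As long as no denominator of the recursion vanishes, the branch above
  \<open>v\<close> draws the current \<open>adm_b v * x p\<close> from the parent \<open>p\<close>, \<open>x v\<close> is a multiple of \<open>x p\<close>, and
  \<open>adm_sb r * x r = 0\<close> remains at the root.  If \<open>adm_sb r\<close> is nonzero, \<open>x\<close> vanishes from the
  root downwards.  Without shunts every \<open>adm_sb v\<close> and \<open>adm_b v\<close> is zero because branch matrices
  have rank one, so the denominators are nonzero and all branch currents vanish.
\<close>

section \<open>Kirchhoff's laws in coordinates\<close>

lemma index_mat_adjoint:
  assumes "i < dim_col A" "j < dim_row A"
  shows "mat_adjoint A $$ (i, j) = conjugate (A $$ (j, i))"
  using assms by (simp add: mat_adjoint_def mat_of_rows_index)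

lemma mat_adjoint_carrier:
  "A \<in> carrier_mat nr nc \<Longrightarrow> mat_adjoint A \<in> carrier_mat nc nr"
  by (auto simp: mat_adjoint_def)

lemma mult_mat_vec_index_sum:
  assumes "A \<in> carrier_mat nr nc" "x \<in> carrier_vec nc" "i < nr"
  shows "(A *\<^sub>v x) $ i = (\<Sum>j<nc. A $$ (i, j) * x $ j)"
  using assms by (auto simp: scalar_prod_def lessThan_atLeast0)

lemma mat_diag_mult_vec_index:
  assumes "x \<in> carrier_vec n" "i < n"
  shows "(mat_diag n f *\<^sub>v x) $ i = f i * (x $ i :: 'a :: semiring_1)"
proof -
  have "(mat_diag n f *\<^sub>v x) $ i = (\<Sum>j<n. (if i = j then f j else 0) * x $ j)"
    using assms by (subst mult_mat_vec_index_sum[of _ n n]) (auto simp: mat_diag_def)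
  also have "\<dots> = (\<Sum>j<n. if j = i then f i * x $ i else 0)"
    by (rule sum.cong) auto
  finally show ?thesis
    using assms by simp
qed

text \<open>For a branch from \<open>i\<close> to \<open>k\<close> with tap ratio \<open>a\<close>
  this is \<open>x i - a * x k\<close>, the voltage across the series element. The goal is that it
  vanishes on every branch.\<close>

definition branch_drop :: "network \<Rightarrow> complex vec \<Rightarrow> nat \<Rightarrow> complex" where
  "branch_drop N x l = (\<Sum>w<num_nodes N. cnj (branch_vec N l $ w) * x $ w)"

definition branch_current :: "network \<Rightarrow> complex vec \<Rightarrow> nat \<Rightarrow> complex" where
  "branch_current N x l = series_adm N l * branch_drop N x l"

lemma incidence_mat_carrier:
  "incidence_mat N \<in> carrier_mat (num_branches N) (num_nodes N)"
  by (auto simp: incidence_mat_def)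

lemma nodal_adm_mat_carrier:
  "nodal_adm_mat N \<in> carrier_mat (num_nodes N) (num_nodes N)"
  by (auto simp: nodal_adm_mat_def shunt_adm_mat_def mat_diag_def)

lemma branch_vec_dim: "dim_vec (branch_vec N l) = num_nodes N"
  by (simp add: branch_vec_def)

lemma incidence_mat_index:
  assumes "l < num_branches N" "v < num_nodes N"
  shows "incidence_mat N $$ (l, v) = cnj (branch_vec N l $ v)"
  using assms by (simp add: incidence_mat_def mat_of_rows_index branch_vec_dim)

lemma incidence_mat_mult_vec:
  assumes "x \<in> carrier_vec (num_nodes N)" "l < num_branches N"
  shows "(incidence_mat N *\<^sub>v x) $ l = branch_drop N x l"
proof -
  have "(incidence_mat N *\<^sub>v x) $ l = (\<Sum>w<num_nodes N. incidence_mat N $$ (l, w) * x $ w)"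
    by (rule mult_mat_vec_index_sum[OF incidence_mat_carrier assms])
  then show ?thesis
    using assms by (simp add: branch_drop_def incidence_mat_index)
qed

text \<open>Kirchhoff's current law: the currents leaving \<open>v\<close> through its branches and
  its shunt. For \<open>x\<close> in the null space this total is zero.\<close>

lemma nodal_adm_mat_mult_vec:
  assumes x: "x \<in> carrier_vec (num_nodes N)" and v: "v < num_nodes N"
  shows "(nodal_adm_mat N *\<^sub>v x) $ v =
    (\<Sum>l<num_branches N. branch_vec N l $ v * branch_current N x l) + node_shunt_adm N v * x $ v"
proof -
  let ?n = "num_nodes N" and ?m = "num_branches N"
  let ?A = "incidence_mat N" and ?D = "series_adm_mat N" and ?T = "shunt_adm_mat N"
  have A: "?A \<in> carrier_mat ?m ?n" and AH: "mat_adjoint ?A \<in> carrier_mat ?n ?m"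
    by (rule incidence_mat_carrier, rule mat_adjoint_carrier, rule incidence_mat_carrier)
  have D: "?D \<in> carrier_mat ?m ?m" and T: "?T \<in> carrier_mat ?n ?n"
    by (simp_all add: series_adm_mat_def shunt_adm_mat_def)
  let ?z = "?D *\<^sub>v (?A *\<^sub>v x)"
  have z: "?z \<in> carrier_vec ?m"
    using A D x by auto
  have z_index: "?z $ l = branch_current N x l" if "l < ?m" for l
    using that A x incidence_mat_mult_vec[OF x that]
    by (simp add: series_adm_mat_def branch_current_def mat_diag_mult_vec_index[where n = ?m])
  have "nodal_adm_mat N *\<^sub>v x = (mat_adjoint ?A * ?D * ?A) *\<^sub>v x + ?T *\<^sub>v x"
    unfolding nodal_adm_mat_def
    by (rule add_mult_distrib_mat_vec[of _ ?n ?n]) (use A AH D T x in auto)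
  also have "(mat_adjoint ?A * ?D * ?A) *\<^sub>v x = (mat_adjoint ?A * ?D) *\<^sub>v (?A *\<^sub>v x)"
    by (rule assoc_mult_mat_vec[of _ ?n ?m _ ?n]) (use A AH D x in auto)
  also have "\<dots> = mat_adjoint ?A *\<^sub>v ?z"
    by (rule assoc_mult_mat_vec[of _ ?n ?m _ ?m]) (use A AH D x in auto)
  finally have "(nodal_adm_mat N *\<^sub>v x) $ v = (mat_adjoint ?A *\<^sub>v ?z) $ v + (?T *\<^sub>v x) $ v"
    using v AH T by simp
  also have "(?T *\<^sub>v x) $ v = node_shunt_adm N v * x $ v"
    unfolding shunt_adm_mat_def by (rule mat_diag_mult_vec_index[OF x v])
  also have "(mat_adjoint ?A *\<^sub>v ?z) $ v = (\<Sum>l<?m. mat_adjoint ?A $$ (v, l) * ?z $ l)"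
    by (rule mult_mat_vec_index_sum[OF AH z v])
  also have "\<dots> = (\<Sum>l<?m. branch_vec N l $ v * branch_current N x l)"
    by (rule sum.cong) (use A v z_index in \<open>auto simp: index_mat_adjoint incidence_mat_index\<close>)
  finally show ?thesis .
qed

text \<open>The product form exhibits rank one, so every \<open>2 x 2\<close> minor vanishes; trees
  without shunts rely on this.\<close>

lemma branch_adm_mat_index:
  assumes "u < num_nodes N" "v < num_nodes N"
  shows "branch_adm_mat N l $$ (u, v) =
    series_adm N l * (branch_vec N l $ u * cnj (branch_vec N l $ v))"
proof -
  define a where "a = mat_of_cols (num_nodes N) [branch_vec N l]"
  have a: "a \<in> carrier_mat (num_nodes N) 1"
    by (auto simp: a_def)
  have aH: "mat_adjoint a \<in> carrier_mat 1 (num_nodes N)"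
    by (rule mat_adjoint_carrier[OF a])
  have "(a * mat_adjoint a) $$ (u, v) = a $$ (u, 0) * mat_adjoint a $$ (0, v)"
    using a aH assms by (auto simp: scalar_prod_def)
  also have "\<dots> = branch_vec N l $ u * cnj (branch_vec N l $ v)"
    using a assms by (simp add: index_mat_adjoint) (simp add: a_def mat_of_cols_def)
  finally show ?thesis
    using a aH assms by (simp add: branch_adm_mat_def Let_def flip: a_def)
qed

section \<open>Paths and cycles\<close>

lemma joins_sym: "joins N l u v \<Longrightarrow> joins N l v u"
  by (auto simp: joins_def)

lemma joins_endpoints:
  assumes "joins N l u v" "joins N l u' v'"
  shows "u' = u \<and> v' = v \<or> u' = v \<and> v' = u"
  using assms by (auto simp: joins_def)

lemma valid_network_joins:
  assumes "valid_network N" "joins N l u v"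
  shows "u < num_nodes N" "v < num_nodes N" "u \<noteq> v" "l < num_branches N"
proof -
  interpret loopfree_digraph "network_graph N"
    using assms by (simp add: valid_network_def)
  have l: "l \<in> arcs (network_graph N)"
    using assms by (simp add: joins_def network_graph_def)
  show "u < num_nodes N" "v < num_nodes N" "u \<noteq> v" "l < num_branches N"
    using assms(2) tail_in_verts[OF l] head_in_verts[OF l] no_loops[OF l]
    by (auto simp: joins_def network_graph_def)
qed

lemma network_connected_reachable:
  assumes "network_connected N" "u < num_nodes N" "v < num_nodes N"
  shows "(u, v) \<in> (adjacent N)\<^sup>*"
proof -
  have "u \<rightarrow>\<^sup>*\<^bsub>with_proj (mk_symmetric (network_graph N))\<^esub> v"
    using assms
    by (simp add: network_connected_def connected_def strongly_connected_def network_graph_def)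
  then have "(u, v) \<in> (parcs (mk_symmetric (network_graph N)))\<^sup>*"
    using reachable_rtranclI by fastforce
  moreover have "parcs (mk_symmetric (network_graph N)) = adjacent N"
    by (auto simp: parcs_mk_symmetric network_graph_def adjacent_def joins_def)
  ultimately show ?thesis
    by simp
qed

text \<open>Only the branch is removed, not the pair of nodes: a branch parallel to \<open>l\<close>
  still connects its ends.\<close>

definition adjacent_without :: "network \<Rightarrow> nat \<Rightarrow> (nat \<times> nat) set" where
  "adjacent_without N l = {(u, v). \<exists>l'. l' \<noteq> l \<and> joins N l' u v}"

lemma adjacent_without_sym: "sym (adjacent_without N l)"
  by (auto simp: adjacent_without_def intro!: symI dest: joins_sym)

text \<open>A walk of minimal length is injective: a repeated node would allow the stretch between
  its two visits to be cut out.\<close>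

lemma rtrancl_imp_simple_path:
  assumes "(u, v) \<in> R\<^sup>*"
  obtains f :: "nat \<Rightarrow> 'a" and k where
    "f 0 = u" "f k = v" "\<And>i. i < k \<Longrightarrow> (f i, f (Suc i)) \<in> R" "inj_on f {..k}"
proof -
  define k where "k = (LEAST k. (u, v) \<in> R ^^ k)"
  obtain k' where "(u, v) \<in> R ^^ k'"
    using assms rtrancl_power by blast
  then have k: "(u, v) \<in> R ^^ k"
    unfolding k_def by (rule LeastI)
  have least: "k \<le> k'" if "(u, v) \<in> R ^^ k'" for k'
    unfolding k_def using that by (rule Least_le)
  from k obtain f where f: "f 0 = u" "f k = v" "\<And>i. i < k \<Longrightarrow> (f i, f (Suc i)) \<in> R"
    unfolding relpow_fun_conv by blast
  have segment: "(f i, f j) \<in> R ^^ (j - i)" if "i \<le> j" "j \<le> k" for i j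
    unfolding relpow_fun_conv
    by (rule exI[of _ "\<lambda>t. f (i + t)"]) (use that f(3) in auto)
  have "f i \<noteq> f j" if "i < j" "j \<le> k" for i j
  proof
    assume eq: "f i = f j"
    have "(f 0, f i) \<in> R ^^ i" "(f j, f k) \<in> R ^^ (k - j)"
      using segment[of 0 i] segment[of j k] that by auto
    then have "(u, v) \<in> R ^^ (i + (k - j))"
      using eq f(1,2) by (auto simp: relpow_add)
    from least[OF this] that show False
      by simp
  qed
  then have "inj_on f {..k}"
    by (intro linorder_inj_onI) auto
  with f that show ?thesis
    by blast
qed

text \<open>A simple path from \<open>u\<close> to \<open>v\<close> avoiding \<open>l\<close> is
  closed to a cycle by \<open>l\<close>.\<close>

lemma cycle_if_bypass:
  assumes "joins N l u v" "u \<noteq> v" "(u, v) \<in> (adjacent_without N l)\<^sup>*"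
  shows "\<exists>vs ls. is_cycle N vs ls"
proof -
  obtain f k where f: "f 0 = u" "f k = v" "inj_on f {..k}"
    "\<And>i. i < k \<Longrightarrow> (f i, f (Suc i)) \<in> adjacent_without N l"
    using rtrancl_imp_simple_path[OF assms(3)] by metis
  then have "\<forall>i<k. \<exists>l'. l' \<noteq> l \<and> joins N l' (f i) (f (Suc i))"
    by (auto simp: adjacent_without_def)
  then obtain e where e: "\<And>i. i < k \<Longrightarrow> e i \<noteq> l" "\<And>i. i < k \<Longrightarrow> joins N (e i) (f i) (f (Suc i))"
    by metis
  \<comment> \<open>A branch determines its unordered pair of ends, so a repeated branch would force
    a repeated node on the simple path.\<close>
  have "e i \<noteq> e j" if "i < j" "j < k" for i j
  proof
    assume "e i = e j"
    then have "f i = f j \<or> f i = f (Suc j)"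
      using joins_endpoints[OF e(2)[of j]] e(2)[of i] that by auto
    then show False
      using inj_onD[OF f(3), of i j] inj_onD[OF f(3), of i "Suc j"] that by auto
  qed
  then have inj_e: "inj_on e {0..<k}"
    by (intro linorder_inj_onI) auto
  define vs where "vs = map f [0..<Suc k]"
  define ls where "ls = map e [0..<k] @ [l]"
  have "joins N (ls ! i) (vs ! i) (vs ! (Suc i mod length ls))" if "i < length ls" for i
  proof (cases "i < k")
    case True
    then show ?thesis
      using e(2) by (simp add: ls_def vs_def nth_append del: upt_Suc)
  next
    case False
    with that have "i = k"
      by (simp add: ls_def)
    \<comment> \<open>Here the successor index wraps around to \<open>0\<close>, and
      \<open>l\<close> is traversed from \<open>v\<close> back to \<open>u\<close>.\<close>
    then show ?thesis
      using f joins_sym[OF assms(1)] by (simp add: ls_def vs_def nth_append del: upt_Suc)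
  qed
  moreover have "distinct vs"
    using f(3) by (simp add: vs_def distinct_map atLeast0LessThan lessThan_Suc_atMost del: upt_Suc)
  moreover have "distinct ls"
    using inj_e e(1) by (fastforce simp: ls_def distinct_map)
  moreover have "ls \<noteq> []" "length vs = length ls"
    by (simp_all add: ls_def vs_def)
  ultimately have "is_cycle N vs ls"
    by (simp add: is_cycle_def)
  then show ?thesis
    by blast
qed

section \<open>Rooted trees\<close>

locale rooted_tree_network =
  fixes N :: network and r :: nat
  assumes valid: "valid_network N"
    and tree: "network_tree N"
    and root: "r < num_nodes N"
begin

abbreviation dep :: "nat \<Rightarrow> nat" where
  "dep \<equiv> depth N r"

abbreviation par :: "nat \<Rightarrow> nat" where
  "par \<equiv> parent N r"

text \<open>Names the branch chosen inside \<open>parent_branch_mat\<close>, so that branches can be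
  indexed by their lower ends.\<close>

definition parent_branch :: "nat \<Rightarrow> nat" where
  "parent_branch v = (THE l. joins N l (par v) v)"

lemma depth_path:
  assumes "v < num_nodes N"
  shows "(r, v) \<in> adjacent N ^^ dep v"
proof -
  have "(r, v) \<in> (adjacent N)\<^sup>*"
    using network_connected_reachable tree root assms by (simp add: network_tree_def)
  then obtain k where "(r, v) \<in> adjacent N ^^ k"
    using rtrancl_power by blast
  then show ?thesis
    unfolding depth_def by (rule LeastI)
qed

lemma depth_le: "(r, v) \<in> adjacent N ^^ k \<Longrightarrow> dep v \<le> k"
  unfolding depth_def by (rule Least_le)

lemma depth_root: "dep r = 0"
  using depth_le[of r 0] by simp

lemma depth_joins:
  assumes "joins N l u v"
  shows "dep v \<le> Suc (dep u)"
proof (rule depth_le)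
  have "(r, u) \<in> adjacent N ^^ dep u"
    using depth_path valid_network_joins[OF valid assms] by blast
  then show "(r, v) \<in> adjacent N ^^ Suc (dep u)"
    using assms by (auto simp: adjacent_def)
qed

text \<open>The parent is the last node but one on a shortest path from the root.\<close>

lemma ex_parent:
  assumes "v < num_nodes N" "v \<noteq> r"
  shows "\<exists>p l. is_parent N r p v \<and> joins N l p v"
proof -
  have path: "(r, v) \<in> adjacent N ^^ dep v"
    using depth_path assms by blast
  with assms(2) obtain k where k: "dep v = Suc k"
    by (cases "dep v") auto
  with path obtain p where p: "(r, p) \<in> adjacent N ^^ k" "(p, v) \<in> adjacent N"
    by auto
  then obtain l where l: "joins N l p v"
    by (auto simp: adjacent_def)
  have "dep v = Suc (dep p)"
    using depth_joins[OF l] depth_le[OF p(1)] k by simp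
  then show ?thesis
    using l p(2) valid_network_joins[OF valid l] by (auto simp: is_parent_def)
qed

text \<open>A shortest path from the root to a node no deeper than the ends of \<open>l\<close> cannot use \<open>l\<close>.\<close>

lemma shallow_reachable_without:
  assumes l: "joins N l u v"
    and w: "w < num_nodes N" "dep w \<le> dep u" "dep w \<le> dep v"
  shows "(r, w) \<in> (adjacent_without N l)\<^sup>*"
  using w
proof (induction "dep w" arbitrary: w rule: less_induct)
  case less
  show ?case
  proof (cases "w = r")
    case False
    then obtain p l' where p: "is_parent N r p w" "joins N l' p w"
      using ex_parent less.prems by blast
    then have "dep w = Suc (dep p)" "p < num_nodes N"
      by (simp_all add: is_parent_def)
    \<comment> \<open>The node \<open>p\<close> is strictly shallower than \<open>w\<close>, hence
      than both ends of \<open>l\<close>, so it is not an end of \<open>l\<close>.\<close>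
    moreover from this have "l' \<noteq> l"
      using joins_endpoints[OF l] p(2) less.prems by fastforce
    ultimately show ?thesis
      using less.hyps[of p] less.prems p(2)
      by (auto simp: adjacent_without_def intro: rtrancl_into_rtrancl)
  qed simp
qed

text \<open>The two walks join at the root to a walk from \<open>u\<close> to \<open>v\<close> that
  avoids \<open>l\<close>, and this would yield a cycle.\<close>

lemma no_bypass:
  assumes "joins N l u v" "(r, u) \<in> (adjacent_without N l)\<^sup>*" "(r, v) \<in> (adjacent_without N l)\<^sup>*"
  shows False
proof -
  have "(u, r) \<in> (adjacent_without N l)\<^sup>*"
    using assms(2) sym_rtrancl[OF adjacent_without_sym] by (blast dest: symD)
  with assms(3) have "(u, v) \<in> (adjacent_without N l)\<^sup>*"
    by simp
  then show False
    using cycle_if_bypass[OF assms(1)] valid_network_joins[OF valid assms(1)] tree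
    by (simp add: network_tree_def)
qed

text \<open>Depths of neighbours differ by at most one. If they were equal, both ends would be
  reachable from the root without \<open>l\<close>.\<close>

lemma joins_depth_cases:
  assumes "joins N l u v"
  shows "dep v = Suc (dep u) \<or> dep u = Suc (dep v)"
proof -
  have "dep u \<noteq> dep v"
    using no_bypass[OF assms] shallow_reachable_without[OF assms] valid_network_joins[OF valid assms]
    by (metis order_refl)
  then show ?thesis
    using depth_joins[OF assms] depth_joins[OF joins_sym[OF assms]] by linarith
qed

text \<open>Makes the uses of \<open>THE\<close> for parents and their branches meaningful. With a
  second upward branch \<open>l'\<close>, both \<open>p\<close> and, through \<open>p'\<close>, also
  \<open>v\<close> would be reachable without \<open>l\<close>.\<close>

lemma upward_branch_unique:
  assumes "joins N l p v" "dep v = Suc (dep p)" "joins N l' p' v" "dep v = Suc (dep p')"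
  shows "l = l'" "p = p'"
proof -
  show "l = l'"
  proof (rule ccontr)
    assume "l \<noteq> l'"
    have "(r, p) \<in> (adjacent_without N l)\<^sup>*" "(r, p') \<in> (adjacent_without N l)\<^sup>*"
      using shallow_reachable_without[OF assms(1)] valid_network_joins[OF valid] assms by auto
    moreover from this have "(r, v) \<in> (adjacent_without N l)\<^sup>*"
      using \<open>l \<noteq> l'\<close> assms(3) by (auto simp: adjacent_without_def intro: rtrancl_into_rtrancl)
    ultimately show False
      using no_bypass[OF assms(1)] by blast
  qed
  then show "p = p'"
    using joins_endpoints[OF assms(1)] assms valid_network_joins(3)[OF valid] by blast
qed

lemma is_parent_iff:
  "is_parent N r p v \<longleftrightarrow> (\<exists>l. joins N l p v) \<and> dep v = Suc (dep p)"
  by (auto simp: is_parent_def adjacent_def dest: valid_network_joins[OF valid])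

lemma parent_eqI: "joins N l p v \<Longrightarrow> dep v = Suc (dep p) \<Longrightarrow> par v = p"
  unfolding parent_def by (rule the_equality) (auto simp: is_parent_iff dest: upward_branch_unique)

lemma parent_branch_eqI: "joins N l p v \<Longrightarrow> dep v = Suc (dep p) \<Longrightarrow> parent_branch v = l"
  unfolding parent_branch_def
  by (rule the_equality) (auto simp: parent_eqI dest: upward_branch_unique)

lemma parent_branch_joins:
  assumes "v < num_nodes N" "v \<noteq> r"
  shows "joins N (parent_branch v) (par v) v" "dep v = Suc (dep (par v))"
proof -
  obtain p l where "is_parent N r p v" "joins N l p v"
    using ex_parent assms by blast
  then show "joins N (parent_branch v) (par v) v" "dep v = Suc (dep (par v))"
    by (auto simp: is_parent_iff parent_eqI parent_branch_eqI)
qed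

lemma children_eq: "children N r v = {i. i < num_nodes N \<and> i \<noteq> r \<and> par i = v}"
proof (intro equalityI subsetI)
  fix i assume "i \<in> children N r v"
  then obtain l where "joins N l v i" "dep i = Suc (dep v)"
    by (auto simp: children_def is_parent_iff)
  then show "i \<in> {i. i < num_nodes N \<and> i \<noteq> r \<and> par i = v}"
    using valid_network_joins[OF valid] depth_root by (auto simp: parent_eqI)
next
  fix i assume "i \<in> {i. i < num_nodes N \<and> i \<noteq> r \<and> par i = v}"
  then show "i \<in> children N r v"
    using parent_branch_joins[of i] by (auto simp: children_def is_parent_iff)
qed

text \<open>Turns sums over branches into sums over non-root nodes. Two nodes sharing a branch would
  be parents of each other, which their depths forbid; conversely, each branch lies above its deeper
  end.\<close>

lemma parent_branch_bij:
  "bij_betw parent_branch ({..<num_nodes N} - {r}) {..<num_branches N}"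
  unfolding bij_betw_def
proof
  show "inj_on parent_branch ({..<num_nodes N} - {r})"
  proof (rule inj_onI)
    fix v w
    assume v: "v \<in> {..<num_nodes N} - {r}" and w: "w \<in> {..<num_nodes N} - {r}"
      and eq: "parent_branch v = parent_branch w"
    have "joins N (parent_branch v) (par v) v" "joins N (parent_branch v) (par w) w"
      using parent_branch_joins(1)[of v] parent_branch_joins(1)[of w] v w eq by auto
    from joins_endpoints[OF this] show "v = w"
    proof
      assume "par w = v \<and> w = par v"
      then show ?thesis
        using parent_branch_joins(2)[of v] parent_branch_joins(2)[of w] v w by auto
    qed simp
  qed
  have lower: "l \<in> parent_branch ` ({..<num_nodes N} - {r})"
    if j: "joins N l u v" and d: "dep v = Suc (dep u)" for l u v
    by (rule image_eqI[of _ _ v])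
      (use parent_branch_eqI[OF j d] valid_network_joins[OF valid j] d depth_root in auto)
  have "{..<num_branches N} \<subseteq> parent_branch ` ({..<num_nodes N} - {r})"
  proof
    fix l assume "l \<in> {..<num_branches N}"
    then have j: "joins N l (branch_from N l) (branch_to N l)"
      by (simp add: joins_def)
    \<comment> \<open>The orientation of a branch is unrelated to the root, so either end may be the
      deeper one.\<close>
    from joins_depth_cases[OF j] show "l \<in> parent_branch ` ({..<num_nodes N} - {r})"
      by (elim disjE) (rule lower[OF j], assumption, rule lower[OF joins_sym[OF j]], assumption)
  qed
  moreover have "parent_branch ` ({..<num_nodes N} - {r}) \<subseteq> {..<num_branches N}"
  proof (rule image_subsetI)
    fix v assume "v \<in> {..<num_nodes N} - {r}"
    then show "parent_branch v \<in> {..<num_branches N}"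
      using valid_network_joins(4)[OF valid parent_branch_joins(1)[of v]] by simp
  qed
  ultimately show "parent_branch ` ({..<num_nodes N} - {r}) = {..<num_branches N}"
    by (rule equalityI[rotated])
qed

section \<open>Branch currents in a rooted tree\<close>

lemma branch_vec_eq_0:
  assumes "joins N l u v" "w < num_nodes N" "w \<noteq> u" "w \<noteq> v"
  shows "branch_vec N l $ w = 0"
  using assms by (auto simp: branch_vec_def joins_def)

lemma branch_vec_neq_0:
  assumes "joins N l u v"
  shows "branch_vec N l $ u \<noteq> 0"
  using assms valid valid_network_joins[OF valid assms]
  by (auto simp: branch_vec_def joins_def valid_network_def)

lemma branch_drop_joins:
  assumes "joins N l u v"
  shows "branch_drop N x l = cnj (branch_vec N l $ u) * x $ u + cnj (branch_vec N l $ v) * x $ v"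
proof -
  have "branch_drop N x l = (\<Sum>w\<in>{u, v}. cnj (branch_vec N l $ w) * x $ w)"
    unfolding branch_drop_def
    by (rule sum.mono_neutral_right)
      (use branch_vec_eq_0[OF assms] valid_network_joins[OF valid assms] in auto)
  then show ?thesis
    using valid_network_joins[OF valid assms] by simp
qed

text \<open>The current flowing from node \<open>v\<close> into the branch above
  \<open>i\<close>.\<close>

abbreviation terminal_current :: "complex vec \<Rightarrow> nat \<Rightarrow> nat \<Rightarrow> complex" where
  "terminal_current x i v \<equiv> branch_vec N (parent_branch i) $ v * branch_current N x (parent_branch i)"

lemma terminal_current_eq:
  assumes "v < num_nodes N" "v \<noteq> r" "w < num_nodes N"
  shows "terminal_current x v w =
    parent_branch_mat N r v $$ (w, par v) * x $ par v + parent_branch_mat N r v $$ (w, v) * x $ v"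
proof -
  have j: "joins N (parent_branch v) (par v) v"
    using parent_branch_joins assms by blast
  show ?thesis
    using assms valid_network_joins[OF valid j] branch_drop_joins[OF j, of x]
    by (simp add: parent_branch_mat_def branch_adm_mat_index branch_current_def algebra_simps
        flip: parent_branch_def)
qed

text \<open>The branches at \<open>v\<close> are the one above \<open>v\<close>, absent for the
  root, and those above its children; all others have a zero entry at \<open>v\<close>.\<close>

lemma sum_branches_eq_children:
  assumes v: "v < num_nodes N"
  shows "(\<Sum>l<num_branches N. branch_vec N l $ v * branch_current N x l) =
    (if v = r then 0 else terminal_current x v v) + (\<Sum>i\<in>children N r v. terminal_current x i v)"
proof -
  let ?S = "(if v = r then {} else {v}) \<union> children N r v"
  have fin: "finite (children N r v)"
    by (simp add: children_eq)
  have disj: "(if v = r then {} else {v}) \<inter> children N r v = {}"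
    using parent_branch_joins(2)[OF v] by (auto simp: children_eq)
  have "(\<Sum>l<num_branches N. branch_vec N l $ v * branch_current N x l) =
      (\<Sum>i\<in>{..<num_nodes N} - {r}. terminal_current x i v)"
    by (rule sum.reindex_bij_betw[OF parent_branch_bij, symmetric])
  also have "\<dots> = (\<Sum>i\<in>?S. terminal_current x i v)"
  proof (rule sum.mono_neutral_right)
    show "\<forall>i\<in>{..<num_nodes N} - {r} - ?S. terminal_current x i v = 0"
    proof
      fix i assume i: "i \<in> {..<num_nodes N} - {r} - ?S"
      then have "branch_vec N (parent_branch i) $ v = 0"
        using v by (intro branch_vec_eq_0[OF parent_branch_joins(1)])
          (auto simp: children_eq split: if_splits)
      then show "terminal_current x i v = 0"
        by simp
    qed
  qed (use v in \<open>auto simp: children_eq\<close>)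
  also have "\<dots> = (if v = r then 0 else terminal_current x v v) +
      (\<Sum>i\<in>children N r v. terminal_current x i v)"
    using disj fin by (subst sum.union_disjoint) auto
  finally show ?thesis .
qed

section \<open>Elimination from the leaves to the root\<close>

lemma leaf_induct [consumes 1, case_names node]:
  assumes "v < num_nodes N"
    and node: "\<And>v. v < num_nodes N \<Longrightarrow> (\<And>i. i \<in> children N r v \<Longrightarrow> P i) \<Longrightarrow> P v"
  shows "P v"
  using assms(1)
\<comment> \<open>Children are one step deeper, so the distance to the maximal depth
  decreases.\<close>
proof (induction "Max (dep ` {..<num_nodes N}) - dep v" arbitrary: v rule: less_induct)
  case less
  show ?case
  proof (rule node[OF less.prems])
    fix i assume "i \<in> children N r v"
    then have i: "i < num_nodes N" "dep i = Suc (dep v)"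
      by (simp_all add: children_def is_parent_def)
    then have "dep i \<le> Max (dep ` {..<num_nodes N})"
      by (intro Max_ge imageI) auto
    with i show "P i"
      by (intro less.hyps) auto
  qed
qed

text \<open>The root is left out of the hypothesis on equivalent admittances, so that the result
  also covers trees without shunts, where \<open>adm_sb N r r\<close> is zero.\<close>

lemma
  assumes x: "x \<in> carrier_vec (num_nodes N)" and kernel: "nodal_adm_mat N *\<^sub>v x = 0\<^sub>v (num_nodes N)"
    and equiv: "\<And>v. v < num_nodes N \<Longrightarrow> v \<noteq> r \<Longrightarrow> equiv_adm_to_ground N r v \<noteq> 0"
  shows kernel_parent_current:
      "\<And>v. v < num_nodes N \<Longrightarrow> v \<noteq> r \<Longrightarrow> terminal_current x v (par v) = adm_b N r v * x $ par v"
    and kernel_root: "adm_sb N r r * x $ r = 0"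
    and kernel_child: "\<And>v. v < num_nodes N \<Longrightarrow> v \<noteq> r \<Longrightarrow> x $ par v = 0 \<Longrightarrow> x $ v = 0"
proof -
  \<comment> \<open>Once each subtree below \<open>v\<close> acts as the admittance
    \<open>adm_b\<close> of its child, these and the shunt at \<open>v\<close> add up to
    \<open>adm_sb\<close>.\<close>
  have KCL: "(if v = r then 0 else terminal_current x v v) + adm_sb N r v * x $ v = 0"
    if v: "v < num_nodes N"
      and IH: "\<And>i. i \<in> children N r v \<Longrightarrow> terminal_current x i v = adm_b N r i * x $ v" for v
  proof -
    have "(\<Sum>i\<in>children N r v. terminal_current x i v) = (\<Sum>i\<in>children N r v. adm_b N r i) * x $ v"
      using IH by (simp add: sum_distrib_right)
    then show ?thesis
      using nodal_adm_mat_mult_vec[OF x v] sum_branches_eq_children[OF v, of x] kernel v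
      by (simp add: adm_sb.simps algebra_simps)
  qed
  have balance: "x $ v * (parent_branch_mat N r v $$ (v, v) + adm_sb N r v) =
      - parent_branch_mat N r v $$ (v, par v) * x $ par v"
    if "v < num_nodes N" "v \<noteq> r"
      and "\<And>i. i \<in> children N r v \<Longrightarrow> terminal_current x i v = adm_b N r i * x $ v" for v
    using KCL[OF that(1,3)] that(2) terminal_current_eq[OF that(1,2,1), of x]
    by (simp add: algebra_simps eq_neg_iff_add_eq_0)
  have nz: "parent_branch_mat N r v $$ (v, v) + adm_sb N r v \<noteq> 0" if "v < num_nodes N" "v \<noteq> r" for v
    using equiv[OF that] that by (simp add: equiv_adm_to_ground_def)
  have cur: "v \<noteq> r \<longrightarrow> terminal_current x v (par v) = adm_b N r v * x $ par v"
    if "v < num_nodes N" for v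
    using that
  proof (induction rule: leaf_induct)
    case (node v)
    show ?case
    proof
      assume "v \<noteq> r"
      let ?e = "parent_branch_mat N r v $$ (v, v) + adm_sb N r v"
      have p: "par v < num_nodes N"
        using valid_network_joins[OF valid parent_branch_joins(1)] node.hyps \<open>v \<noteq> r\<close> by blast
      have "x $ v * ?e = - parent_branch_mat N r v $$ (v, par v) * x $ par v"
        using node.IH \<open>v \<noteq> r\<close> \<open>v < num_nodes N\<close>
        by (intro balance) (auto simp: children_eq)
      then have "x $ v = - parent_branch_mat N r v $$ (v, par v) * x $ par v / ?e"
        by (simp only: nonzero_eq_divide_eq[OF nz[OF node.hyps \<open>v \<noteq> r\<close>]])
      \<comment> \<open>Inserting this quotient into the row of \<open>par v\<close> produces the
        Schur complement that defines \<open>adm_b\<close>.\<close>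
      then show "terminal_current x v (par v) = adm_b N r v * x $ par v"
        using terminal_current_eq[OF node.hyps \<open>v \<noteq> r\<close> p, of x]
        by (simp add: adm_b.simps[of N r v] algebra_simps)
    qed
  qed
  then show "terminal_current x v (par v) = adm_b N r v * x $ par v"
    if "v < num_nodes N" "v \<noteq> r" for v
    using that by blast
  have children: "terminal_current x i v = adm_b N r i * x $ v" if "i \<in> children N r v" for i v
    using that cur by (auto simp: children_eq)
  show "adm_sb N r r * x $ r = 0"
    using KCL[OF root children] by simp
  show "x $ v = 0" if "v < num_nodes N" "v \<noteq> r" "x $ par v = 0" for v
    using balance[OF that(1,2) children] nz[OF that(1,2)] that(3) by simp
qed

text \<open>At the root, \<open>adm_sb\<close> is nonzero and forces \<open>x r = 0\<close>; zeros
  then spread from parents to children by induction on depth.\<close>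

lemma tree_kernel_eq_0:
  assumes x: "x \<in> carrier_vec (num_nodes N)" and kernel: "nodal_adm_mat N *\<^sub>v x = 0\<^sub>v (num_nodes N)"
    and equiv: "\<And>v. v < num_nodes N \<Longrightarrow> equiv_adm_to_ground N r v \<noteq> 0"
    and v: "v < num_nodes N"
  shows "x $ v = 0"
  using v
proof (induction "dep v" arbitrary: v rule: less_induct)
  case less
  show ?case
  proof (cases "v = r")
    case True
    then show ?thesis
      using kernel_root[OF x kernel equiv] equiv[OF root] by (simp add: equiv_adm_to_ground_def)
  next
    case False
    note j = parent_branch_joins[OF less.prems False]
    have "x $ par v = 0"
      using less.hyps[of "par v"] j(2) valid_network_joins[OF valid j(1)] by simp
    then show ?thesis
      using kernel_child[OF x kernel equiv less.prems False] by blast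
  qed
qed

text \<open>With \<open>adm_sb = 0\<close> the denominator is the diagonal entry of a branch matrix,
  nonzero because the series admittance and the tap ratio are. The vanishing \<open>2 x 2\<close>
  minor then gives \<open>adm_b = 0\<close>, and zeros add up to the next
  \<open>adm_sb\<close>.\<close>

lemma shuntless_adm:
  assumes "shunts N = {}" and series: "\<forall>l<num_branches N. series_adm N l \<noteq> 0"
    and v: "v < num_nodes N"
  shows "adm_sb N r v = 0 \<and> (v \<noteq> r \<longrightarrow> equiv_adm_to_ground N r v \<noteq> 0 \<and> adm_b N r v = 0)"
  using v
proof (induction rule: leaf_induct)
  case (node v)
  have "adm_sb N r v = (\<Sum>i\<in>children N r v. 0)"
    unfolding adm_sb.simps[of N r v]
    using node.IH assms(1) by (auto simp: node_shunt_adm_def children_eq)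
  then have sb: "adm_sb N r v = 0"
    by simp
  moreover have "equiv_adm_to_ground N r v \<noteq> 0 \<and> adm_b N r v = 0" if "v \<noteq> r"
  proof -
    note j = parent_branch_joins(1)[OF node.hyps that]
    note ends = valid_network_joins[OF valid j]
    have nz: "branch_vec N (parent_branch v) $ v \<noteq> 0" "series_adm N (parent_branch v) \<noteq> 0"
      using branch_vec_neq_0[OF joins_sym[OF j]] series ends by auto
    have Y: "parent_branch_mat N r v = branch_adm_mat N (parent_branch v)"
      by (simp add: parent_branch_mat_def parent_branch_def)
    show ?thesis
      using nz sb that ends
      by (simp add: equiv_adm_to_ground_def adm_b.simps[of N r v] Y branch_adm_mat_index)
  qed
  ultimately show ?case
    by blast
qed

text \<open>Each branch lies above some node \<open>v\<close>. Its current at \<open>par v\<close>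
  is zero since \<open>adm_b\<close> is, and the factors other than the drop are nonzero.\<close>

lemma shuntless_kernel_drop_eq_0:
  assumes x: "x \<in> carrier_vec (num_nodes N)" and kernel: "nodal_adm_mat N *\<^sub>v x = 0\<^sub>v (num_nodes N)"
    and shunts: "shunts N = {}" and series: "\<forall>l<num_branches N. series_adm N l \<noteq> 0"
    and l: "l < num_branches N"
  shows "branch_drop N x l = 0"
proof -
  obtain v where v: "v < num_nodes N" "v \<noteq> r" "l = parent_branch v"
    using l parent_branch_bij by (auto simp: bij_betw_def)
  have "terminal_current x v (par v) = adm_b N r v * x $ par v"
    using shuntless_adm[OF shunts series] v by (intro kernel_parent_current[OF x kernel]) auto
  also have "\<dots> = 0"
    using shuntless_adm[OF shunts series] v by simp
  finally show ?thesis
    using v series l branch_vec_neq_0[OF parent_branch_joins(1)[OF v(1,2)]]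
    by (simp add: branch_current_def)
qed

end

section \<open>Networks of a single reactance type\<close>

text \<open>The factor \<open>s\<close> stands for \<open>- \<i>\<close> or \<open>\<i>\<close>,
  which treats inductors and capacitors at once.\<close>

lemma reactive_kernel_drop_eq_0:
  assumes x: "x \<in> carrier_vec (num_nodes N)" and kernel: "nodal_adm_mat N *\<^sub>v x = 0\<^sub>v (num_nodes N)"
    and s: "s \<noteq> 0"
    and series: "\<And>l. l < num_branches N \<Longrightarrow> \<exists>b>0. series_adm N l = s * complex_of_real b"
    and shunt: "\<And>v. v \<in> shunts N \<Longrightarrow> \<exists>b>0. shunt_adm N v = s * complex_of_real b"
    and l: "l < num_branches N"
  shows "branch_drop N x l = 0"
proof -
  let ?n = "num_nodes N" and ?m = "num_branches N"
  have "\<exists>b. \<forall>l<?m. b l > 0 \<and> series_adm N l = s * complex_of_real (b l)"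
    using series by metis
  then obtain b where b: "\<And>l. l < ?m \<Longrightarrow> b l > 0" "\<And>l. l < ?m \<Longrightarrow> series_adm N l = s * complex_of_real (b l)"
    by blast
  \<comment> \<open>Only nonnegative: nodes without a shunt have \<open>c = 0\<close>.\<close>
  have "\<exists>c\<ge>0. node_shunt_adm N v = s * complex_of_real c" for v
  proof (cases "v \<in> shunts N")
    case True
    then show ?thesis
      using shunt[OF True] by (auto simp: node_shunt_adm_def intro: less_imp_le)
  next
    case False
    then show ?thesis
      by (intro exI[of _ 0]) (simp add: node_shunt_adm_def)
  qed
  then obtain c where c: "\<And>v. c v \<ge> 0" "\<And>v. node_shunt_adm N v = s * complex_of_real (c v)"
    by metis
  define P where "P = (\<Sum>l<?m. b l * (cmod (branch_drop N x l))\<^sup>2)"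
  define Q where "Q = (\<Sum>v<?n. c v * (cmod (x $ v))\<^sup>2)"
  have drop: "(\<Sum>v<?n. cnj (x $ v) * branch_vec N l $ v) = cnj (branch_drop N x l)" for l
    by (simp add: branch_drop_def mult.commute)
  have norm_sq: "(complex_of_real (cmod z))\<^sup>2 = z * cnj z" for z
    by (metis complex_norm_square of_real_power)
  \<comment> \<open>The quadratic form of the nodal matrix splits into \<open>s * P\<close> from the
    branches and \<open>s * Q\<close> from the shunts.\<close>
  have "0 = (\<Sum>v<?n. cnj (x $ v) * (nodal_adm_mat N *\<^sub>v x) $ v)"
    by (simp add: kernel)
  also have "\<dots> = (\<Sum>v<?n. \<Sum>l<?m. cnj (x $ v) * branch_vec N l $ v * branch_current N x l) +
      (\<Sum>v<?n. cnj (x $ v) * (node_shunt_adm N v * x $ v))"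
    by (simp add: nodal_adm_mat_mult_vec[OF x] sum_distrib_left sum.distrib algebra_simps)
  also have "(\<Sum>v<?n. \<Sum>l<?m. cnj (x $ v) * branch_vec N l $ v * branch_current N x l) =
      (\<Sum>l<?m. cnj (branch_drop N x l) * branch_current N x l)"
    by (subst sum.swap) (simp add: drop flip: sum_distrib_right)
  also have "\<dots> = s * complex_of_real P"
    unfolding P_def of_real_sum sum_distrib_left
    by (rule sum.cong) (simp_all add: branch_current_def b(2) norm_sq algebra_simps)
  also have "(\<Sum>v<?n. cnj (x $ v) * (node_shunt_adm N v * x $ v)) = s * complex_of_real Q"
    unfolding Q_def of_real_sum sum_distrib_left
    by (rule sum.cong) (simp_all add: c(2) norm_sq algebra_simps)
  finally have "s * complex_of_real (P + Q) = 0"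
    by (simp add: distrib_left)
  with s have "P + Q = 0"
    by (metis mult_eq_0_iff of_real_eq_0_iff)
  moreover have "P \<ge> 0" "Q \<ge> 0"
    using b(1)[THEN less_imp_le] c(1) by (auto simp: P_def Q_def intro!: sum_nonneg)
  ultimately have "P = 0"
    by simp
  \<comment> \<open>A vanishing sum of nonnegative terms vanishes termwise.\<close>
  then have "b l * (cmod (branch_drop N x l))\<^sup>2 = 0"
    using b(1) l unfolding P_def
    by (subst (asm) sum_nonneg_eq_0_iff) (auto simp: less_imp_le)
  then show ?thesis
    using b(1)[OF l] by simp
qed

section \<open>The null space inclusion under each condition\<close>

theorem theorem3:
  fixes N :: network
  assumes "valid_network N"
    and "network_connected N"
    and "\<forall>l<num_branches N. series_adm N l \<noteq> 0"
    and "(network_tree N \<and>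
            (\<exists>r<num_nodes N. \<forall>v<num_nodes N. equiv_adm_to_ground N r v \<noteq> 0))
       \<or> (network_tree N \<and> shunts N = {})
       \<or> ((\<forall>l<num_branches N. is_inductor_adm (series_adm N l)) \<and>
            (\<forall>v\<in>shunts N. is_inductor_adm (shunt_adm N v)))
       \<or> ((\<forall>l<num_branches N. is_capacitor_adm (series_adm N l)) \<and>
            (\<forall>v\<in>shunts N. is_capacitor_adm (shunt_adm N v)))"
  shows "mat_kernel (nodal_adm_mat N) \<subseteq> mat_kernel (incidence_mat N)"
proof
  fix x assume "x \<in> mat_kernel (nodal_adm_mat N)"
  from mat_kernelD[OF nodal_adm_mat_carrier this]
  have x: "x \<in> carrier_vec (num_nodes N)" and kernel: "nodal_adm_mat N *\<^sub>v x = 0\<^sub>v (num_nodes N)"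
    by blast+
  have "branch_drop N x l = 0" if l: "l < num_branches N" for l
    using assms(4)
  proof (elim disjE conjE exE)
    fix r assume tree: "network_tree N" and r: "r < num_nodes N"
      and equiv: "\<forall>v<num_nodes N. equiv_adm_to_ground N r v \<noteq> 0"
    interpret rooted_tree_network N r
      using assms(1) tree r by unfold_locales
    show ?thesis
      using tree_kernel_eq_0[OF x kernel] equiv by (simp add: branch_drop_def)
  next
    assume tree: "network_tree N" and shunts: "shunts N = {}"
    \<comment> \<open>Any root will do; node \<open>0\<close> exists because the node set is
      nonempty.\<close>
    interpret rooted_tree_network N 0
      using assms(1) tree by unfold_locales (simp_all add: valid_network_def)
    show ?thesis
      using shuntless_kernel_drop_eq_0[OF x kernel shunts assms(3) l] .
  next
    assume "\<forall>l<num_branches N. is_inductor_adm (series_adm N l)"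
      and "\<forall>v\<in>shunts N. is_inductor_adm (shunt_adm N v)"
    then show ?thesis
      by (intro reactive_kernel_drop_eq_0[OF x kernel, of "- \<i>"])
        (use l in \<open>auto simp: is_inductor_adm_def\<close>)
  next
    assume "\<forall>l<num_branches N. is_capacitor_adm (series_adm N l)"
      and "\<forall>v\<in>shunts N. is_capacitor_adm (shunt_adm N v)"
    then show ?thesis
      by (intro reactive_kernel_drop_eq_0[OF x kernel, of \<i>])
        (use l in \<open>auto simp: is_capacitor_adm_def\<close>)
  qed
  then have "incidence_mat N *\<^sub>v x = 0\<^sub>v (num_branches N)"
    using incidence_mat_mult_vec[OF x] incidence_mat_carrier[of N] by (intro eq_vecI) auto
  with x show "x \<in> mat_kernel (incidence_mat N)"
    by (intro mat_kernelI[OF incidence_mat_carrier])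
qed

end
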